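(* Let $k \in \mathbb{N}$ (a positive integer), let $\tau_k = k+2-\frac{1}{k+2}$, and let $\varepsilon > 0$. Suppose that a graph $G$ has $n \ge 2$ vertices and $m$ edges, and that $\frac{2m}{n} \le \tau_k - \varepsilon$. Then $\rho_k(G) \ge \frac{2\varepsilon}{5\tau_k}$.
   Context: All graphs are finite and simple. The $k$-many firefighter process on a graph $G=(V,E)$: a fire breaks out at a vertex $v \in V$. In each subsequent time unit, a firefighter first protects up to $k$ vertices that are not yet on fire, and then the fire spreads to all unprotected neighbours of the vertices on fire. Once a vertex is on fire or protected it stays so forever; the process ends when the fire can no longer spread. Let $\mathrm{sn}_k(G,v)$ be the maximum number of vertices that are not burned at the end of the process (i.e. saved), over all firefighter strategies, when the fire breaks out at $v$. The surviving rate is $\rho_k(G) = \frac{1}{n^2}\sum_{v \in V} \mathrm{sn}_k(G,v)$, where $n=|V|$. *)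

theory Defs
  imports Complex_Main
begin

definition simple_graph :: "'a set \<Rightarrow> 'a set set \<Rightarrow> bool" where
  "simple_graph V E \<longleftrightarrow> finite V \<and> (\<forall>e\<in>E. e \<subseteq> V \<and> card e = 2)"

text \<open>
  A run of the firefighter is a sequence \<open>P\<close>, where \<open>P t\<close> is the set of vertices that are newly
  protected in the time unit leading from time \<open>t\<close> to time \<open>t + 1\<close>. Since the process is
  deterministic once \<open>P\<close> is fixed, adaptive strategies achieve nothing more than such sequences.
  \<open>on_fire V E P v t\<close> is the set of vertices on fire at time \<open>t\<close> if the fire breaks out at \<open>v\<close>
  at time \<open>0\<close>: in each time unit \<open>P t\<close> is protected first, and then the fire spreads.
\<close>

primrec on_fire :: "'a set \<Rightarrow> 'a set set \<Rightarrow> (nat \<Rightarrow> 'a set) \<Rightarrow> 'a \<Rightarrow> nat \<Rightarrow> 'a set" where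
  "on_fire V E P v 0 = {v}"
| "on_fire V E P v (Suc t) = on_fire V E P v t \<union>
     {w \<in> V. (\<exists>u \<in> on_fire V E P v t. {u, w} \<in> E) \<and> w \<notin> (\<Union>s\<le>t. P s)}"

definition strategy ::
    "nat \<Rightarrow> 'a set \<Rightarrow> 'a set set \<Rightarrow> 'a \<Rightarrow> (nat \<Rightarrow> 'a set) \<Rightarrow> bool" where
  "strategy k V E v P \<longleftrightarrow> (\<forall>t. P t \<subseteq> V - on_fire V E P v t \<and> card (P t) \<le> k)"

text \<open>
  The sets \<open>on_fire V E P v t\<close> increase with \<open>t\<close> and stay constant once the fire has failed to
  spread in one time unit (lemma \<open>on_fire_final\<close> below), so their union is the set of vertices
  burned at the end of the process.
\<close>

definition saved :: "'a set \<Rightarrow> 'a set set \<Rightarrow> (nat \<Rightarrow> 'a set) \<Rightarrow> 'a \<Rightarrow> 'a set" where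
  "saved V E P v = V - (\<Union>t. on_fire V E P v t)"

definition sn :: "nat \<Rightarrow> 'a set \<Rightarrow> 'a set set \<Rightarrow> 'a \<Rightarrow> nat" where
  "sn k V E v = Max {card (saved V E P v) | P. strategy k V E v P}"

definition surviving_rate :: "nat \<Rightarrow> 'a set \<Rightarrow> 'a set set \<Rightarrow> real" where
  "surviving_rate k V E = 1 / (real (card V))\<^sup>2 * (\<Sum>v\<in>V. real (sn k V E v))"

definition tau :: "nat \<Rightarrow> real" where
  "tau k = real k + 2 - 1 / (real k + 2)"

lemma on_fire_final:
  assumes "on_fire V E P v (Suc t) = on_fire V E P v t"
  shows "(\<Union>s. on_fire V E P v s) = on_fire V E P v t"
proof -
  have after: "on_fire V E P v (t + d) = on_fire V E P v t" for d
  proof (induction d)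
    case (Suc d)
    have "(\<Union>s\<le>t. P s) \<subseteq> (\<Union>s\<le>t + d. P s)" by (intro UN_mono) auto
    then have "on_fire V E P v (Suc (t + d)) \<subseteq> on_fire V E P v (Suc t)"
      unfolding on_fire.simps Suc.IH by blast
    then show ?case using assms Suc.IH by auto
  qed simp
  have "on_fire V E P v s \<subseteq> on_fire V E P v t" for s
  proof (cases "s \<le> t")
    case True
    then show ?thesis by (rule lift_Suc_mono_le[rotated]) auto
  next
    case False
    then show ?thesis using after[of "s - t"] by simp
  qed
  then show ?thesis by blast
qed

text \<open>The maximum defining \<open>sn\<close> is taken over a finite nonempty set.\<close>

lemma sn_Max_wf:
  assumes "finite V"
  shows "finite {card (saved V E P v) | P. strategy k V E v P}"
    and "{card (saved V E P v) | P. strategy k V E v P} \<noteq> {}"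
proof -
  have "{card (saved V E P v) | P. strategy k V E v P} \<subseteq> {..card V}"
    using assms by (auto simp: saved_def intro: card_mono)
  then show "finite {card (saved V E P v) | P. strategy k V E v P}"
    by (rule finite_subset) simp
  have "strategy k V E v (\<lambda>_. {})"
    by (simp add: strategy_def)
  then show "{card (saved V E P v) | P. strategy k V E v P} \<noteq> {}"
    by blast
qed

end

theory Submission
  imports Defs
begin

text \<open>
  A fire at a vertex \<open>v\<close> burns at most three vertices if \<open>v\<close> has degree at most \<open>k\<close>, or if it has
  degree \<open>k + 1\<close> and either a neighbour of degree at most \<open>k + 1\<close> or a neighbour of degree \<open>k + 2\<close>
  that has another neighbour of degree at most \<open>k + 1\<close>: the fire is led along such a path by
  protecting everything else around it. Let every other vertex of degree \<open>k + 1\<close> receive charge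
  \<open>1 / (k + 2)\<close> from each of its neighbours, all of which have degree at least \<open>k + 2\<close>. As
  \<open>tau k = (k + 1) * (k + 3) / (k + 2)\<close>, all vertices from which the fire cannot be stopped in this
  way then have charge at least \<open>tau k\<close>, so a proportion of at least \<open>\<epsilon> / tau k\<close> of the vertices is
  good. A good vertex saves at least \<open>n - 3\<close> vertices, which is at least \<open>2 * n / 5\<close> for \<open>n \<ge> 5\<close>;
  the graphs with at most four vertices are treated directly.
\<close>

section \<open>Neighbourhoods, degrees and the handshake identity\<close>

definition nbhd :: "'a set \<Rightarrow> 'a set set \<Rightarrow> 'a \<Rightarrow> 'a set" where
  "nbhd V E v = {w \<in> V. {v, w} \<in> E}"

lemma nbhd_commute: "u \<in> V \<Longrightarrow> v \<in> nbhd V E u \<Longrightarrow> u \<in> nbhd V E v"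
  by (simp add: nbhd_def insert_commute)

lemma finite_nbhd: "simple_graph V E \<Longrightarrow> finite (nbhd V E v)"
  by (simp add: simple_graph_def nbhd_def)

lemma finite_edges: "simple_graph V E \<Longrightarrow> finite E"
  by (auto simp: simple_graph_def intro: finite_subset[of E "Pow V"])

lemma card_nbhd_eq_incident:
  assumes "simple_graph V E" and "v \<in> V"
  shows "card (nbhd V E v) = card {e \<in> E. v \<in> e}"
proof -
  have "inj_on (\<lambda>w. {v, w}) (nbhd V E v)"
    by (auto simp: inj_on_def doubleton_eq_iff)
  moreover have "(\<lambda>w. {v, w}) ` nbhd V E v = {e \<in> E. v \<in> e}"
  proof
    show "{e \<in> E. v \<in> e} \<subseteq> (\<lambda>w. {v, w}) ` nbhd V E v"
    proof
      fix e assume e: "e \<in> {e \<in> E. v \<in> e}"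
      then have "card e = 2" "e \<subseteq> V" using assms by (auto simp: simple_graph_def)
      then obtain x y where "e = {x, y}" by (auto simp: card_2_iff)
      then obtain w where "e = {v, w}" using e by auto
      then show "e \<in> (\<lambda>w. {v, w}) ` nbhd V E v"
        using e \<open>e \<subseteq> V\<close> by (auto simp: nbhd_def)
    qed
  qed (auto simp: nbhd_def)
  ultimately show ?thesis by (metis card_image)
qed

lemma sum_card_nbhd:
  assumes "simple_graph V E"
  shows "(\<Sum>v\<in>V. card (nbhd V E v)) = 2 * card E"
proof -
  have fin: "finite V" using assms by (simp add: simple_graph_def)
  have "(\<Sum>v\<in>V. card (nbhd V E v)) = (\<Sum>v\<in>V. card {e \<in> E. v \<in> e})"
    using assms by (simp add: card_nbhd_eq_incident)
  also have "\<dots> = 2 * card E"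
  proof (rule sum_multicount[OF fin finite_edges[OF assms]], rule ballI)
    fix e assume "e \<in> E"
    then have "e \<subseteq> V" "card e = 2" using assms by (auto simp: simple_graph_def)
    moreover from this have "{v \<in> V. v \<in> e} = e" by auto
    ultimately show "card {v \<in> V. v \<in> e} = 2" by simp
  qed
  finally show ?thesis .
qed

section \<open>Lower bounds on \<open>sn\<close> from explicit strategies\<close>

lemma card_saved_le_sn:
  assumes "finite V" and "strategy k V E v P"
  shows "card (saved V E P v) \<le> sn k V E v"
  unfolding sn_def using sn_Max_wf[OF assms(1)] assms(2) by (auto intro: Max_ge)

text \<open>A fixed set \<open>A\<close> avoiding \<open>v\<close> may be protected anew in every
  time unit, since it never burns. This serves for small graphs, where saving \<open>n - 3\<close>
  vertices is too weak.\<close>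

lemma min_le_sn:
  assumes fin: "finite V"
  shows "min k (card (V - {v})) \<le> sn k V E v"
proof -
  obtain A where A: "A \<subseteq> V - {v}" "card A = min k (card (V - {v}))"
    by (meson min.cobounded2 obtain_subset_with_card_n)
  have disj: "on_fire V E (\<lambda>_. A) v t \<inter> A = {}" for t
    using A(1) by (induction t) auto
  then have "strategy k V E v (\<lambda>_. A)"
    using A by (auto simp: strategy_def)
  moreover have "A \<subseteq> saved V E (\<lambda>_. A) v"
    using A(1) disj by (auto simp: saved_def)
  then have "card A \<le> card (saved V E (\<lambda>_. A) v)"
    using fin by (intro card_mono) (auto simp: saved_def)
  ultimately show ?thesis
    using card_saved_le_sn[OF fin, of k E v "\<lambda>_. A"] A(2) by simp
qed

text \<open>Time unit \<open>i\<close> protects all neighbours of \<open>x i\<close> except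
  \<open>x 0, ..., x (i + 1)\<close>: the earlier terms may already burn, and
  \<open>x (i + 1)\<close> is left open as the next place for the fire. So at time \<open>t\<close>
  only \<open>x 0, ..., x t\<close> can burn. A finite path is encoded as an eventually constant
  sequence, with its vertices in \<open>B\<close>.\<close>

lemma sn_ge_path:
  fixes x :: "nat \<Rightarrow> 'a"
  assumes fin: "finite V" and rng: "range x \<subseteq> B" "finite B"
    and bound: "\<And>i. card (nbhd V E (x i) - x ` {..Suc i}) \<le> k"
  shows "card V \<le> sn k V E (x 0) + card B"
proof -
  define P where "P i = nbhd V E (x i) - x ` {..Suc i}" for i
  have fire: "on_fire V E P (x 0) t \<subseteq> x ` {..t}" for t
  proof (induction t)
    case (Suc t)
    have "w \<in> x ` {..Suc t}"
      if "w \<in> V" "u \<in> on_fire V E P (x 0) t" "{u, w} \<in> E" "w \<notin> (\<Union>s\<le>t. P s)" for u w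
    proof -
      obtain j where j: "u = x j" "j \<le> t" using Suc.IH \<open>u \<in> _\<close> by auto
      then have "w \<in> nbhd V E (x j)" "w \<notin> P j" using that by (auto simp: nbhd_def)
      then have "w \<in> x ` {..Suc j}" by (simp add: P_def)
      then show ?thesis using j by auto
    qed
    moreover have "x ` {..t} \<subseteq> x ` {..Suc t}" by auto
    ultimately show ?case using Suc.IH by auto
  qed simp
  have "P t \<subseteq> V - on_fire V E P (x 0) t" for t
  proof -
    have "x ` {..t} \<subseteq> x ` {..Suc t}" by auto
    then show ?thesis using fire[of t] by (auto simp: P_def nbhd_def)
  qed
  then have strat: "strategy k V E (x 0) P"
    using bound by (simp add: strategy_def P_def)
  have "(\<Union>t. on_fire V E P (x 0) t) \<subseteq> B" using fire rng(1) by blast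
  then have "V \<subseteq> saved V E P (x 0) \<union> B" by (auto simp: saved_def)
  then have "card V \<le> card (saved V E P (x 0) \<union> B)"
    using fin rng(2) by (intro card_mono) (auto simp: saved_def)
  also have "\<dots> \<le> card (saved V E P (x 0)) + card B" by (rule card_Un_le)
  finally show ?thesis using card_saved_le_sn[OF fin strat] by simp
qed

lemma sn_ge_low_degree:
  assumes G: "simple_graph V E" and deg: "card (nbhd V E v) \<le> k"
  shows "card V \<le> sn k V E v + 1"
proof -
  have "card (nbhd V E v - A) \<le> k" for A
    using deg by (meson G Diff_subset card_mono finite_nbhd le_trans)
  then show ?thesis
    using sn_ge_path[of V "\<lambda>_. v" "{v}" E k] G by (simp add: simple_graph_def)
qed

text \<open>The fire is led along \<open>v, u, u, ...\<close>. Each of \<open>v\<close> and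
  \<open>u\<close> has the other as an exempt neighbour, so at most \<open>k\<close> vertices remain
  to be protected around it.\<close>

lemma sn_ge_low_neighbour:
  assumes G: "simple_graph V E" and v: "v \<in> V" "card (nbhd V E v) \<le> k + 1"
    and u: "u \<in> nbhd V E v" "card (nbhd V E u) \<le> k + 1"
  shows "card V \<le> sn k V E v + 2"
proof -
  define x where "x i = (if i = 0 then v else u)" for i :: nat
  have ran: "x ` {..Suc i} = {v, u}" for i
    by (auto simp: x_def image_iff intro: bexI[of _ "Suc 0"])
  have "v \<in> nbhd V E u" using nbhd_commute[OF v(1) u(1)] .
  then have 1: "card (nbhd V E u - {v}) \<le> k"
    using u(2) finite_nbhd[OF G] by simp
  have 2: "card (nbhd V E v - {u}) \<le> k"
    using v(2) u(1) finite_nbhd[OF G] by simp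
  have bound: "card (nbhd V E (x i) - x ` {..Suc i}) \<le> k" for i
  proof (cases "i = 0")
    case True
    have "card (nbhd V E v - {v, u}) \<le> card (nbhd V E v - {u})"
      using finite_nbhd[OF G] by (intro card_mono) auto
    then show ?thesis unfolding ran using 2 True by (simp add: x_def)
  next
    case False
    have "card (nbhd V E u - {v, u}) \<le> card (nbhd V E u - {v})"
      using finite_nbhd[OF G] by (intro card_mono) auto
    then show ?thesis unfolding ran using 1 False by (simp add: x_def)
  qed
  have "card V \<le> sn k V E (x 0) + card {v, u}"
    by (rule sn_ge_path) (use G bound in \<open>auto simp: simple_graph_def x_def\<close>)
  moreover have "card {v, u} \<le> 2" by (simp add: card_insert_if)
  ultimately show ?thesis by (simp add: x_def)
qed

text \<open>The fire is led along \<open>v, u, w, w, ...\<close>. The middle vertex has two exempt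
  neighbours, so its degree may be \<open>k + 2\<close>; each end has one.\<close>

lemma sn_ge_second_neighbour:
  assumes G: "simple_graph V E" and v: "v \<in> V" "card (nbhd V E v) \<le> k + 1"
    and u: "u \<in> nbhd V E v" "card (nbhd V E u) \<le> k + 2"
    and w: "w \<in> nbhd V E u" "w \<noteq> v" "card (nbhd V E w) \<le> k + 1"
  shows "card V \<le> sn k V E v + 3"
proof -
  define x where "x i = (if i = 0 then v else if i = 1 then u else w)" for i :: nat
  have x: "x 0 = v" "x (Suc 0) = u" "x (Suc (Suc i)) = w" for i by (auto simp: x_def)
  have uV: "u \<in> V" using u(1) by (simp add: nbhd_def)
  have fin: "finite (nbhd V E a)" for a using finite_nbhd[OF G] .
  have 0: "card (nbhd V E v - {u}) \<le> k"
    using v(2) u(1) fin by simp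
  have "card (nbhd V E u - {v, w}) = card (nbhd V E u) - card {v, w}"
    using nbhd_commute[OF v(1) u(1)] w(1) by (intro card_Diff_subset) auto
  then have 1: "card (nbhd V E u - {v, w}) \<le> k" using u(2) w(2) by simp
  have 2: "card (nbhd V E w - {u}) \<le> k"
    using w(3) nbhd_commute[OF uV w(1)] fin by simp
  have bound: "card (nbhd V E (x i) - x ` {..Suc i}) \<le> k" for i
  proof -
    consider "i = 0" | "i = Suc 0" | j where "i = Suc (Suc j)" by (metis not0_implies_Suc)
    then show ?thesis
    proof cases
      case 1
      have "u \<in> x ` {..Suc i}" by (rule image_eqI[of _ _ "Suc 0"]) (auto simp: 1 x)
      then have "card (nbhd V E (x i) - x ` {..Suc i}) \<le> card (nbhd V E v - {u})"
        using fin by (intro card_mono) (auto simp: 1 x)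
      then show ?thesis using 0 by simp
    next
      case 2
      have "x ` {..Suc i} = {v, u, w}"
        by (auto simp: 2 x atMost_Suc)
      then have "card (nbhd V E (x i) - x ` {..Suc i}) \<le> card (nbhd V E u - {v, w})"
        using fin by (intro card_mono) (auto simp: 2 x)
      then show ?thesis using 1 by simp
    next
      case 3
      have "u \<in> x ` {..Suc i}" by (rule image_eqI[of _ _ "Suc 0"]) (auto simp: 3 x)
      then have "card (nbhd V E (x i) - x ` {..Suc i}) \<le> card (nbhd V E w - {u})"
        using fin by (intro card_mono) (auto simp: 3 x)
      then show ?thesis using 2 by simp
    qed
  qed
  have "card V \<le> sn k V E (x 0) + card {v, u, w}"
    by (rule sn_ge_path) (use G bound in \<open>auto simp: simple_graph_def x_def\<close>)
  moreover have "card {v, u, w} \<le> 3" by (simp add: card_insert_if)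
  ultimately show ?thesis by (simp add: x_def)
qed

section \<open>Discharging\<close>

lemma tau_eq: "tau k = (real k + 1) * (real k + 3) / (real k + 2)"
  by (simp add: tau_def field_simps)

lemma tau_pos: "tau k > 0"
  by (simp add: tau_eq)

lemma tau_mult_flammable_le:
  fixes k :: nat
  assumes G: "simple_graph V E"
  defines "S \<equiv> {v \<in> V. card V \<le> sn k V E v + 3}"
  shows "tau k * real (card (V - S)) \<le> 2 * real (card E)"
proof -
  define d where "d v = card (nbhd V E v)" for v
  define B where "B = {v \<in> V - S. d v = k + 1}"
  \<comment> \<open>\<open>H\<close> is taken in all of \<open>V\<close>, because the neighbours
    giving charge to \<open>B\<close> are not known to lie outside \<open>S\<close>.\<close>
  define H where "H = {v \<in> V. d v \<ge> k + 2}"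
  have finV: "finite V" using G by (simp add: simple_graph_def)
  have fin: "finite B" "finite H" "finite (nbhd V E v)" for v
    using finV by (auto simp: B_def H_def nbhd_def)
  have low: "v \<in> S" if "v \<in> V" "d v \<le> k" for v
    using sn_ge_low_degree[OF G, of v k] that by (simp add: S_def d_def)
  have cover: "V - S \<subseteq> B \<union> H"
    using low by (force simp: B_def H_def)
  have B_nbhd: "d u \<ge> k + 2" if "b \<in> B" "u \<in> nbhd V E b" for b u
  proof (rule ccontr)
    assume "\<not> d u \<ge> k + 2"
    then have "card V \<le> sn k V E b + 2"
      using sn_ge_low_neighbour[OF G, of b k u] that by (simp add: B_def d_def)
    then show False using that by (auto simp: B_def S_def)
  qed
  define N where "N h = card (nbhd V E h \<inter> B)" for h
  have N_le_1: "N h \<le> 1" if "h \<in> V" "d h = k + 2" for h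
  proof (rule ccontr)
    \<comment> \<open>Two receivers \<open>b\<close> and \<open>w\<close> next to \<open>h\<close>
      would give the path \<open>b, h, w\<close>, which puts \<open>b\<close> into
      \<open>S\<close>.\<close>
    assume "\<not> N h \<le> 1"
    then obtain b w where bw: "b \<in> nbhd V E h \<inter> B" "w \<in> nbhd V E h \<inter> B" "w \<noteq> b"
      by (metis N_def card_le_Suc0_iff_eq One_nat_def fin(1) finite_Int)
    then have "card V \<le> sn k V E b + 3"
      using sn_ge_second_neighbour[OF G, of b k h w] nbhd_commute[of h V b E] that
      by (auto simp: B_def d_def)
    then show False using bw by (auto simp: B_def S_def)
  qed
  have big: "tau k + real (N h) / (real k + 2) \<le> real (d h)" if h: "h \<in> V" "d h \<ge> k + 2" for h
  proof (cases "d h = k + 2")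
    case True
    then have "real (N h) / (real k + 2) \<le> 1 / (real k + 2)"
      using N_le_1[OF h(1)] by (intro divide_right_mono) auto
    then show ?thesis using True by (simp add: tau_def)
  next
    \<comment> \<open>Even if \<open>h\<close> gives to every neighbour, it keeps the fraction
      \<open>(k + 1) / (k + 2)\<close> of its degree; at degree \<open>k + 3\<close> this is exactly
      \<open>tau k\<close>.\<close>
    case False
    then have "d h \<ge> k + 3" using h by simp
    have "N h \<le> d h" using fin by (auto simp: N_def d_def intro: card_mono)
    then have "real (N h) / (real k + 2) \<le> real (d h) / (real k + 2)"
      by (intro divide_right_mono) auto
    moreover have "tau k \<le> (real k + 1) * real (d h) / (real k + 2)"
      unfolding tau_eq using \<open>d h \<ge> k + 3\<close> by (intro divide_right_mono mult_left_mono) auto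
    moreover have "(real k + 1) * real (d h) / (real k + 2) + real (d h) / (real k + 2) = real (d h)"
      by (subst add_divide_distrib[symmetric], subst nonzero_divide_eq_eq)
        (auto simp: algebra_simps add_nonneg_eq_0_iff)
    ultimately show ?thesis by linarith
  qed
  \<comment> \<open>Double counting of the edges between \<open>H\<close> and \<open>B\<close>: all
    \<open>k + 1\<close> neighbours of a vertex of \<open>B\<close> lie in \<open>H\<close>.\<close>
  have "(\<Sum>h\<in>H. N h) = (\<Sum>h\<in>H. card {b \<in> B. b \<in> nbhd V E h})"
    by (simp add: N_def Int_def conj_commute)
  also have "\<dots> = (k + 1) * card B"
  proof (rule sum_multicount[OF fin(2,1)], rule ballI)
    fix b assume b: "b \<in> B"
    then have "{h \<in> H. b \<in> nbhd V E h} = nbhd V E b"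
      using B_nbhd[OF b] by (auto simp: H_def nbhd_def B_def insert_commute)
    then show "card {h \<in> H. b \<in> nbhd V E h} = k + 1" using b by (simp add: B_def d_def)
  qed
  finally have "(\<Sum>h\<in>H. real (N h)) = (real k + 1) * real (card B)"
    by (metis (mono_tags) of_nat_sum of_nat_mult of_nat_add of_nat_1)
  then have "(\<Sum>h\<in>H. tau k + real (N h) / (real k + 2)) =
      tau k * real (card H) + (real k + 1) * real (card B) / (real k + 2)"
    by (simp add: sum.distrib flip: sum_divide_distrib)
  moreover have "(\<Sum>h\<in>H. tau k + real (N h) / (real k + 2)) \<le> (\<Sum>h\<in>H. real (d h))"
    using big by (intro sum_mono) (auto simp: H_def)
  moreover have "(\<Sum>b\<in>B. real (d b)) = (real k + 1) * real (card B)"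
    by (simp add: B_def)
  moreover have "(\<Sum>b\<in>B. real (d b)) + (\<Sum>h\<in>H. real (d h)) \<le> (\<Sum>v\<in>V. real (d v))"
  proof -
    have "(\<Sum>v\<in>B \<union> H. real (d v)) = (\<Sum>b\<in>B. real (d b)) + (\<Sum>h\<in>H. real (d h))"
      using fin by (intro sum.union_disjoint) (auto simp: B_def H_def)
    moreover have "(\<Sum>v\<in>B \<union> H. real (d v)) \<le> (\<Sum>v\<in>V. real (d v))"
      using finV by (intro sum_mono2) (auto simp: B_def H_def)
    ultimately show ?thesis by simp
  qed
  moreover have "(\<Sum>v\<in>V. real (d v)) = 2 * real (card E)"
    unfolding d_def using sum_card_nbhd[OF G] by (metis of_nat_sum of_nat_mult of_nat_numeral)
  \<comment> \<open>A receiver ends with charge \<open>(k + 1) * (1 + 1 / (k + 2))\<close>, which is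
    again exactly \<open>tau k\<close>.\<close>
  moreover have "tau k * real (card B) =
      (real k + 1) * real (card B) + (real k + 1) * real (card B) / (real k + 2)"
    by (simp add: tau_eq field_simps)
  moreover have "card (V - S) \<le> card B + card H"
    using card_mono[OF _ cover] card_Un_le[of B H] fin by simp
  then have "tau k * real (card (V - S)) \<le> tau k * (real (card B) + real (card H))"
    using tau_pos[of k] by (intro mult_left_mono) linarith+
  ultimately show ?thesis by (simp add: distrib_left)
qed

section \<open>Averaging and the small graphs\<close>

lemma surviving_rate_ge:
  assumes "finite V" and "V \<noteq> {}" and "S \<subseteq> V"
    and "\<And>v. v \<in> S \<Longrightarrow> c * real (card V) \<le> real (sn k V E v)"
  shows "c * (real (card S) / real (card V)) \<le> surviving_rate k V E"
proof -
  have n: "real (card V) > 0" using assms by (simp add: card_gt_0_iff)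
  have "real (card S) * (c * real (card V)) \<le> (\<Sum>v\<in>S. real (sn k V E v))"
    using sum_mono[of S "\<lambda>_. c * real (card V)"] assms(4) by simp
  also have "\<dots> \<le> (\<Sum>v\<in>V. real (sn k V E v))"
    using assms by (intro sum_mono2) auto
  finally show ?thesis
    using n by (simp add: surviving_rate_def field_simps power2_eq_square)
qed

theorem theorem2:
  fixes k :: nat and \<epsilon> :: real and V :: "'a set" and E :: "'a set set"
  assumes "k \<ge> 1" and "\<epsilon> > 0"
    and "simple_graph V E"
    and "card V \<ge> 2"
    and "2 * real (card E) / real (card V) \<le> tau k - \<epsilon>"
  shows "surviving_rate k V E \<ge> 2 * \<epsilon> / (5 * tau k)"
proof -
  note G = assms(3)
  have finV: "finite V" using G by (simp add: simple_graph_def)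
  have n: "real (card V) > 0" "V \<noteq> {}" using assms(4) by auto
  \<comment> \<open>Since the average degree is nonnegative, the target is at most 2/5, so it is
    enough if every vertex saves \<open>2 * n / 5\<close> vertices.\<close>
  have "0 \<le> 2 * real (card E) / real (card V)" by simp
  then have "\<epsilon> \<le> tau k" using assms(5) by linarith
  then have "\<epsilon> / tau k \<le> 1" using tau_pos[of k] by simp
  then have all: ?thesis if "\<And>v. v \<in> V \<Longrightarrow> 2 / 5 * real (card V) \<le> real (sn k V E v)"
    using surviving_rate_ge[OF finV n(2) subset_refl that] n by simp
  have min_sn: "min k (card V - 1) \<le> sn k V E v" if "v \<in> V" for v
    using min_le_sn[OF finV, of k v E] that finV by simp
  consider "card V \<ge> 5" | "card V \<le> 4" "k \<ge> 2" | "card V \<le> 4" "k = 1" "card E \<le> 1"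
    | "card V \<le> 4" "k = 1" "card E \<ge> 2"
    using assms(1) by linarith
  then show ?thesis
  proof cases
    case 1
    define S where "S = {v \<in> V. card V \<le> sn k V E v + 3}"
    have S: "S \<subseteq> V" by (auto simp: S_def)
    have "tau k * real (card (V - S)) \<le> (tau k - \<epsilon>) * real (card V)"
      using tau_mult_flammable_le[OF G, of k] assms(5) n(1) by (simp add: S_def field_simps)
    moreover have "real (card (V - S)) = real (card V) - real (card S)"
      using S finV by (simp add: card_Diff_subset finite_subset card_mono of_nat_diff)
    ultimately have "\<epsilon> * real (card V) \<le> tau k * real (card S)"
      by (simp add: algebra_simps)
    then have "\<epsilon> / tau k \<le> real (card S) / real (card V)"
      using n(1) tau_pos[of k] by (simp add: field_simps)
    moreover have "2 / 5 * (real (card S) / real (card V)) \<le> surviving_rate k V E"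
      by (rule surviving_rate_ge[OF finV n(2) S]) (use 1 in \<open>auto simp: S_def\<close>)
    moreover have "2 * \<epsilon> / (5 * tau k) = 2 / 5 * (\<epsilon> / tau k)" by simp
    ultimately show ?thesis by linarith
  next
    \<comment> \<open>At least \<open>min 2 (n - 1)\<close> vertices are saved, which exceeds
      \<open>2 * n / 5\<close> for \<open>n\<close> = 2, 3, 4.\<close>
    case 2
    show ?thesis
    proof (rule all)
      fix v assume "v \<in> V"
      then show "2 / 5 * real (card V) \<le> real (sn k V E v)"
        using min_sn[of v] 2 assms(4) by (simp add: min_def split: if_splits)
    qed
  next
    \<comment> \<open>With at most one edge all degrees are at most \<open>k = 1\<close>, so only
      the starting vertex burns.\<close>
    case 3
    show ?thesis
    proof (rule all)
      fix v assume "v \<in> V"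
      then have "card (nbhd V E v) \<le> card E"
        using card_nbhd_eq_incident[OF G] finite_edges[OF G] by (auto intro: card_mono)
      then have "card V \<le> sn k V E v + 1" using sn_ge_low_degree[OF G] 3 by simp
      then show "2 / 5 * real (card V) \<le> real (sn k V E v)" using assms(4) by simp
    qed
  next
    \<comment> \<open>Saving one vertex per fire gives only the rate
      \<open>1 / n \<ge> 1 / 4\<close>. But two edges on at most four vertices force average degree
      at least 1, so \<open>\<epsilon> \<le> tau 1 - 1 = 5 / 3\<close>, and the target is at most
      1/4 as well.\<close>
    case 4
    have "1 / real (card V) * (real (card V) / real (card V)) \<le> surviving_rate k V E"
    proof (rule surviving_rate_ge[OF finV n(2) subset_refl])
      fix v assume "v \<in> V"
      then show "1 / real (card V) * real (card V) \<le> real (sn k V E v)"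
        using min_sn[of v] 4 assms(4) n by (simp add: min_def split: if_splits)
    qed
    then have "1 / real (card V) \<le> surviving_rate k V E" using n by simp
    moreover have "1 / 4 \<le> 1 / real (card V)" using 4 n by (simp add: field_simps)
    ultimately have "1 / 4 \<le> surviving_rate k V E" by linarith
    moreover have "1 \<le> 2 * real (card E) / real (card V)"
      using 4 n by (simp add: field_simps)
    then have "\<epsilon> \<le> 5 / 3" using assms(5) 4 by (simp add: tau_def)
    ultimately show ?thesis using 4 by (simp add: tau_def)
  qed
qed

end
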